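(* Let $\{f_n\}_{n\ge1}$ be a martingale difference and let $p_n=\sum_{j\in G_n}c_jf_j$, $n=1,2,\ldots$, be a sequence of $L^2$-normalized ($\|p_n\|_2=1$) non-overlapping polynomials with respect to $\{f_n\}$, where the sets $G_n\subset\mathbb N$ are finite and pairwise disjoint and $c_j\in\mathbb R$. Let $\omega(n)\nearrow\infty$ be a sequence of positive numbers such that $\omega(n)/\log n$, $n\ge2$, is increasing and $$\sum_{n=1}^\infty\frac1{n\,\omega(n)}<\infty.$$ Then $\omega(n)$ is a UC-multiplier for $\{p_n\}$.
   Context: Functions are real-valued, on $[0,1)$ with Lebesgue measure; $\log$ has base $2$. A partition of $[0,1)$ is a (finite or infinite) sequence of pairwise disjoint measurable sets with union $[0,1)$. A filtration is a sequence $\mathcal A_n$, $n=1,2,\ldots$, of partitions of $[0,1)$ such that every $A\in\mathcal A_n$ is a union of some sets from $\mathcal A_{n+1}$ (called children of $A$). A martingale difference based on a filtration $\{\mathcal A_n\}$ is a sequence of functions $f_n\in L^1(0,1)$, $n=1,2,\ldots$, such that (1) $f_n$ is constant on each $A\in\mathcal A_n$; (2) $\int_A f_n=0$ for every $A\in\mathcal A_{n-1}$, $n\ge2$. A martingale difference is such a sequence for some filtration. A sequence of positive numbers $\omega(n)\nearrow\infty$ is an a.e. unconditional convergence Weyl multiplier (UC-multiplier) for an orthonormal system $\{\phi_n\}$ if every series $\sum_{n=1}^\infty a_n\phi_n(x)$ with real coefficients satisfying $\sum_{n=1}^\infty a_n^2\,\omega(n)<\infty$ converges unconditionally a.e.,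 i.e. for every bijection $\sigma:\mathbb N\to\mathbb N$ the series $\sum_{n=1}^\infty a_{\sigma(n)}\phi_{\sigma(n)}(x)$ converges for a.e. $x$ (the exceptional null set may depend on $\sigma$). *)

theory Defs
  imports "HOL-Analysis.Analysis"
begin

text \<open>Sequences indexed by the positive integers are functions on \<^typ>\<open>nat\<close> whose value
  at \<open>0\<close> is irrelevant: quantifiers carry a guard such as \<open>1 \<le> n\<close>, and the
  series over \<open>n \<ge> 1\<close> of \<open>u n\<close> is the series of \<open>\<lambda>k. u (Suc k)\<close>.\<close>

abbreviation unit_leb :: "real measure" where
  "unit_leb \<equiv> lebesgue_on {0..<1}"

text \<open>A finite or infinite sequence of pairwise disjoint sets is a countable disjoint family.
  The empty set is allowed as a member, so this is not \<^const>\<open>partition_on\<close>.\<close>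

definition unit_partition :: "real set set \<Rightarrow> bool" where
  "unit_partition P \<longleftrightarrow>
     countable P \<and> P \<subseteq> sets lebesgue \<and> disjoint P \<and> \<Union>P = {0..<1}"

definition filtration :: "(nat \<Rightarrow> real set set) \<Rightarrow> bool" where
  "filtration \<A> \<longleftrightarrow>
     (\<forall>n\<ge>1. unit_partition (\<A> n)) \<and>
     (\<forall>n\<ge>1. \<forall>A\<in>\<A> n. \<exists>\<C>\<subseteq>\<A> (n + 1). A = \<Union>\<C>)"

definition martingale_difference_wrt ::
    "(nat \<Rightarrow> real set set) \<Rightarrow> (nat \<Rightarrow> real \<Rightarrow> real) \<Rightarrow> bool" where
  "martingale_difference_wrt \<A> f \<longleftrightarrow>
     (\<forall>n\<ge>1. integrable unit_leb (f n)) \<and>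
     (\<forall>n\<ge>1. \<forall>A\<in>\<A> n. f n constant_on A) \<and>
     (\<forall>n\<ge>2. \<forall>A\<in>\<A> (n - 1). (LINT x:A|lebesgue. f n x) = 0)"

definition martingale_difference :: "(nat \<Rightarrow> real \<Rightarrow> real) \<Rightarrow> bool" where
  "martingale_difference f \<longleftrightarrow> (\<exists>\<A>. filtration \<A> \<and> martingale_difference_wrt \<A> f)"

definition in_L2 :: "(real \<Rightarrow> real) \<Rightarrow> bool" where
  "in_L2 g \<longleftrightarrow> g \<in> borel_measurable unit_leb \<and> integrable unit_leb (\<lambda>x. (g x)\<^sup>2)"

definition L2_normalized :: "(real \<Rightarrow> real) \<Rightarrow> bool" where
  "L2_normalized g \<longleftrightarrow> in_L2 g \<and> sqrt (LINT x|unit_leb. (g x)\<^sup>2) = 1"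

definition orthonormal_system :: "(nat \<Rightarrow> real \<Rightarrow> real) \<Rightarrow> bool" where
  "orthonormal_system \<phi> \<longleftrightarrow>
     (\<forall>n\<ge>1. L2_normalized (\<phi> n)) \<and>
     (\<forall>m\<ge>1. \<forall>n\<ge>1. m \<noteq> n \<longrightarrow> (LINT x|unit_leb. \<phi> m x * \<phi> n x) = 0)"

definition increases_to_infinity :: "(nat \<Rightarrow> real) \<Rightarrow> bool" where
  "increases_to_infinity \<omega> \<longleftrightarrow>
     mono_on {1..} \<omega> \<and> filterlim \<omega> at_top sequentially"

text \<open>The exceptional null set may depend on the rearrangement \<open>\<sigma>\<close>.\<close>

definition unconditionally_convergent_ae :: "(nat \<Rightarrow> real \<Rightarrow> real) \<Rightarrow> bool" where
  "unconditionally_convergent_ae g \<longleftrightarrow>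
     (\<forall>\<sigma>. bij_betw \<sigma> {1..} {1..} \<longrightarrow>
        (AE x in unit_leb. summable (\<lambda>k. g (\<sigma> (Suc k)) x)))"

text \<open>Being a multiplier for \<open>\<phi>\<close> includes that \<open>\<phi>\<close> is an orthonormal system.\<close>

definition UC_multiplier :: "(nat \<Rightarrow> real) \<Rightarrow> (nat \<Rightarrow> real \<Rightarrow> real) \<Rightarrow> bool" where
  "UC_multiplier \<omega> \<phi> \<longleftrightarrow>
     orthonormal_system \<phi> \<and>
     (\<forall>n\<ge>1. 0 < \<omega> n) \<and> increases_to_infinity \<omega> \<and>
     (\<forall>a :: nat \<Rightarrow> real.
        summable (\<lambda>k. (a (Suc k))\<^sup>2 * \<omega> (Suc k)) \<longrightarrow>
        unconditionally_convergent_ae (\<lambda>n x. a n * \<phi> n x))"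

end

theory Submission
  imports Defs "HOL-Probability.Conditional_Expectation" "HOL-Library.Discrete_Functions"
begin

text \<open>Let \<open>d\<^sub>j = c\<^sub>j f\<^sub>j\<close> and \<open>V\<^sub>n = \<Sum>\<^bsub>j \<in> G\<^sub>n\<^esub> (d\<^sub>j\<^sup>2 + E[d\<^sub>j\<^sup>2 | \<A>\<^bsub>j-1\<^esub>])\<close>, so that \<open>V\<^sub>n\<close> has
  integral \<open>2\<close>. The inequality \<open>exp (x - x\<^sup>2/2) \<le> 1 + x + x\<^sup>2/2\<close> shows that
  \<open>exp (\<lambda> S - \<lambda>\<^sup>2 W / 2)\<close> has integral at most \<open>2\<close> for \<open>S = \<Sum>\<^bsub>n \<in> B\<^esub> a\<^sub>n p\<^sub>n\<close>, \<open>W = \<Sum>\<^bsub>n \<in> B\<^esub> a\<^sub>n\<^sup>2 V\<^sub>n\<close>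
  and every finite \<open>B\<close>, because the \<open>p\<^sub>n\<close> do not overlap.

  Split the indices into the blocks \<open>2^2^k \<le> n < 2^2^(k+1)\<close>. A rearrangement induces at most
  \<open>4^2^k\<close> different partial sums \<open>S\<close> in the \<open>k\<close>-th block, so the exponential bound with
  \<open>\<lambda> = \<plusminus>\<omega>(2^2^k)\<close> yields almost everywhere, for large \<open>k\<close> and all these \<open>S\<close>,
  \<open>\<bar>S\<bar> \<le> 3 \<cdot> 2^k / \<omega>(2^2^k) + \<omega>(2^2^k) W\<^sub>k / 2\<close>, where \<open>W\<^sub>k\<close> is the sum over the whole block.
  The first term is summable over \<open>k\<close> by Cauchy condensation applied twice to
  \<open>\<Sum> 1 / (n \<omega>(n))\<close>, the second almost everywhere because \<open>\<Sum> a\<^sub>n\<^sup>2 \<omega>(n) V\<^sub>n\<close> has finite integral.\<close>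

section \<open>Real sequences and series\<close>

text \<open>The derivative of \<open>h\<close> has the sign of its argument, so the minimum of
  \<open>h\<close> is \<open>h 0 = 0\<close>. The quadratic correction in the exponent is what later
  replaces any boundedness of the increments.\<close>

lemma exp_diff_half_square_le:
  fixes x :: real
  shows "exp (x - x\<^sup>2 / 2) \<le> 1 + x + x\<^sup>2 / 2"
proof -
  define q where "q y = 1 + y + y\<^sup>2 / 2" for y :: real
  define h where "h y = ln (q y) - y + y\<^sup>2 / 2" for y :: real
  have q_pos: "q y > 0" for y
  proof -
    have "q y = ((1 + y)\<^sup>2 + 1) / 2"
      by (simp add: q_def power2_eq_square field_simps)
    also have "\<dots> > 0"
      by (intro divide_pos_pos add_nonneg_pos) auto
    finally show ?thesis .
  qed
  have deriv: "(h has_real_derivative y * (1 + y / 2 + y\<^sup>2 / 2) / q y) (at y)" for y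
  proof -
    have "(h has_real_derivative (1 + y) / q y - 1 + y) (at y)"
      unfolding h_def q_def using q_pos[of y, unfolded q_def]
      by (auto intro!: derivative_eq_intros simp: field_simps)
    moreover have "(1 + y) / q y - 1 + y = y * (1 + y / 2 + y\<^sup>2 / 2) / q y"
      using q_pos[of y] by (simp add: field_simps) (simp add: q_def power2_eq_square algebra_simps)
    ultimately show ?thesis by simp
  qed
  have factor: "1 + y / 2 + y\<^sup>2 / 2 \<ge> 0" for y :: real
  proof -
    have "1 + y / 2 + y\<^sup>2 / 2 = ((y + 1 / 2)\<^sup>2 + 7 / 4) / 2"
      by (simp add: power2_eq_square field_simps)
    also have "\<dots> \<ge> 0" by simp
    finally show ?thesis .
  qed
  have "h 0 \<le> h x"
  proof (cases "0 \<le> x")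
    case True
    then show ?thesis
      by (rule DERIV_nonneg_imp_nondecreasing)
        (metis deriv divide_nonneg_pos factor mult_nonneg_nonneg q_pos)
  next
    case False
    then have "x \<le> 0" by simp
    then show ?thesis
      by (rule DERIV_nonpos_imp_nonincreasing)
        (metis deriv divide_nonpos_pos factor mult_nonpos_nonneg q_pos)
  qed
  then have "x - x\<^sup>2 / 2 \<le> ln (q x)"
    by (simp add: h_def q_def)
  then have "exp (x - x\<^sup>2 / 2) \<le> q x"
    using q_pos[of x] by (simp add: ln_ge_iff)
  then show ?thesis by (simp add: q_def)
qed

text \<open>Comparable finite sets of equal size coincide, so \<open>card\<close> is injective on
  the chain. A rearrangement visits a block along such a chain, which keeps the union bound linear
  in the block size.\<close>

lemma card_chain_le:
  assumes "finite X" "\<C> \<subseteq> Pow X" and chain: "\<And>A B. A \<in> \<C> \<Longrightarrow> B \<in> \<C> \<Longrightarrow> A \<subseteq> B \<or> B \<subseteq> A"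
  shows "card \<C> \<le> Suc (card X)"
proof -
  have fin: "finite A" if "A \<in> \<C>" for A
    by (rule finite_subset[OF _ assms(1)]) (use that assms(2) in auto)
  have "inj_on card \<C>"
    by (rule inj_onI) (metis chain card_subset_eq fin)
  moreover have "card ` \<C> \<subseteq> {..card X}"
    using assms by (auto intro!: card_mono)
  ultimately show ?thesis
    using card_inj_on_le[of card \<C> "{..card X}"] by simp
qed

text \<open>Finitely many fibres form a finite set of indices, and its sum is at most the whole
  series. This turns the weighted condition on the coefficients into a summable bound per
  block.\<close>

lemma summable_sum_fibres:
  fixes h :: "nat \<Rightarrow> real" and \<kappa> :: "nat \<Rightarrow> nat"
  assumes fin: "\<And>k. finite {n. 1 \<le> n \<and> \<kappa> n = k}"
    and nonneg: "\<And>n. 1 \<le> n \<Longrightarrow> 0 \<le> h n"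
    and sum: "summable (\<lambda>i. h (Suc i))"
  shows "summable (\<lambda>k. \<Sum>n | 1 \<le> n \<and> \<kappa> n = k. h n)"
proof (rule bounded_imp_summable)
  show "0 \<le> (\<Sum>n | 1 \<le> n \<and> \<kappa> n = k. h n)" for k
    using nonneg by (auto intro: sum_nonneg)
  show "(\<Sum>k\<le>m. \<Sum>n | 1 \<le> n \<and> \<kappa> n = k. h n) \<le> (\<Sum>i. h (Suc i))" for m
  proof -
    let ?U = "\<Union>k\<in>{..m}. {n. 1 \<le> n \<and> \<kappa> n = k}"
    have U: "finite ?U" using fin by auto
    \<comment> \<open>The shift translates indices starting at 1 into arguments of
      \<open>Suc\<close>.\<close>
    have inj: "inj_on (\<lambda>n. n - 1) ?U"
      by (rule inj_onI) auto
    have "(\<Sum>k\<le>m. \<Sum>n | 1 \<le> n \<and> \<kappa> n = k. h n) = sum h ?U"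
      using fin by (subst sum.UNION_disjoint) auto
    also have "\<dots> = sum (\<lambda>i. h (Suc i)) ((\<lambda>n. n - 1) ` ?U)"
      by (subst sum.reindex[OF inj]) (auto intro!: sum.cong)
    also have "\<dots> \<le> (\<Sum>i. h (Suc i))"
      using U nonneg by (intro sum_le_suminf sum) auto
    finally show ?thesis .
  qed
qed

text \<open>The sums over a fixed fibre stabilise along the rearrangement, so their domination by a
  summable sequence puts Tannery's theorem in charge of the whole partial sums.\<close>

lemma summable_rearranged_blocks:
  fixes u :: "nat \<Rightarrow> real" and \<kappa> :: "nat \<Rightarrow> nat"
  assumes \<sigma>: "bij_betw \<sigma> {1..} {1..}"
    and fin: "\<And>k. finite {n. 1 \<le> n \<and> \<kappa> n = k}"
    and bound: "\<forall>\<^sub>F k in sequentially. \<forall>m. \<bar>\<Sum>n | n \<in> \<sigma> ` {1..m} \<and> \<kappa> n = k. u n\<bar> \<le> e k"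
    and e: "summable e"
  shows "summable (\<lambda>i. u (\<sigma> (Suc i)))"
proof -
  define T where "T k m = (\<Sum>n | n \<in> \<sigma> ` {1..m} \<and> \<kappa> n = k. u n)" for k m
  have inj: "inj_on \<sigma> {1..}" and img: "\<sigma> ` {1..} = {1..}"
    using \<sigma> by (auto simp: bij_betw_def)
  have "(\<lambda>m. T k m) \<longlonglongrightarrow> (\<Sum>n | 1 \<le> n \<and> \<kappa> n = k. u n)" for k
  proof (rule tendsto_eventually)
    obtain L where L: "L \<subseteq> {1..}" "finite L" "{n. 1 \<le> n \<and> \<kappa> n = k} = \<sigma> ` L"
      using finite_subset_image[OF fin[of k], of \<sigma> "{1..}"] img by auto
    \<comment> \<open>The first \<open>m0\<close> positions of the rearrangement exhaust the
      \<open>k\<close>-th fibre.\<close>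
    obtain m0 where m0: "\<forall>i\<in>L. i \<le> m0"
      using L(2) finite_nat_set_iff_bounded_le by blast
    have "{n. n \<in> \<sigma> ` {1..m} \<and> \<kappa> n = k} = {n. 1 \<le> n \<and> \<kappa> n = k}" if "m0 \<le> m" for m
    proof
      show "{n. n \<in> \<sigma> ` {1..m} \<and> \<kappa> n = k} \<subseteq> {n. 1 \<le> n \<and> \<kappa> n = k}"
        using img by fastforce
      have "L \<subseteq> {1..m}"
        using L(1) m0 that by fastforce
      then have "\<sigma> ` L \<subseteq> \<sigma> ` {1..m}" by blast
      then show "{n. 1 \<le> n \<and> \<kappa> n = k} \<subseteq> {n. n \<in> \<sigma> ` {1..m} \<and> \<kappa> n = k}"
        using L(3) by blast
    qed
    then show "\<forall>\<^sub>F m in sequentially. T k m = (\<Sum>n | 1 \<le> n \<and> \<kappa> n = k. u n)"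
      unfolding T_def eventually_sequentially by (intro exI[of _ m0]) auto
  qed
  moreover have "\<forall>\<^sub>F (k, m) in sequentially \<times>\<^sub>F sequentially. norm (T k m) \<le> e k"
    unfolding eventually_prod_filter
    using bound by (intro exI[of _ "\<lambda>k. \<forall>m. norm (T k m) \<le> e k"] exI[of _ "\<lambda>_. True"])
      (auto simp: T_def)
  ultimately have "(\<lambda>m. \<Sum>k. T k m) \<longlonglongrightarrow> (\<Sum>k. \<Sum>n | 1 \<le> n \<and> \<kappa> n = k. u n)"
    using tannerys_theorem[of T "\<lambda>k. \<Sum>n | 1 \<le> n \<and> \<kappa> n = k. u n" sequentially e] e by simp
  moreover have "(\<Sum>k. T k m) = (\<Sum>i<m. u (\<sigma> (Suc i)))" for m
  proof -
    let ?K = "\<kappa> ` \<sigma> ` {1..m}"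
    have "(\<Sum>k. T k m) = (\<Sum>k\<in>?K. T k m)"
      by (rule suminf_finite) (auto simp: T_def intro!: sum.neutral)
    also have "\<dots> = sum u (\<sigma> ` {1..m})"
      unfolding T_def by (rule sum.group) auto
    also have "\<dots> = (\<Sum>i\<in>{1..m}. u (\<sigma> i))"
      using inj_on_subset[OF inj, of "{1..m}"] by (subst sum.reindex) auto
    also have "\<dots> = (\<Sum>i<m. u (\<sigma> (Suc i)))"
      by (rule sum.reindex_bij_witness[of _ Suc "\<lambda>i. i - 1"]) auto
    finally show ?thesis .
  qed
  ultimately show ?thesis
    by (auto simp: summable_def sums_def)
qed

text \<open>Cauchy condensation is applied twice, which turns \<open>1 / (n * \<omega> n)\<close> first into
  \<open>1 / \<omega> (2 ^ n)\<close>.\<close>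

lemma summable_double_condensation:
  fixes \<omega> :: "nat \<Rightarrow> real"
  assumes pos: "\<And>n. 1 \<le> n \<Longrightarrow> 0 < \<omega> n"
    and mono: "mono_on {1..} \<omega>"
    and sum: "summable (\<lambda>k. 1 / (real (Suc k) * \<omega> (Suc k)))"
  shows "summable (\<lambda>k. 2 ^ k / \<omega> (2 ^ 2 ^ k))"
proof -
  have le: "\<omega> m \<le> \<omega> n" if "1 \<le> m" "m \<le> n" for m n
    using mono_onD[OF mono] that by auto
  have dec: "1 / \<omega> n \<le> 1 / \<omega> m" if "1 \<le> m" "m \<le> n" for m n
    using that by (intro divide_left_mono le mult_pos_pos pos) auto
  define f where "f n = (if n = 0 then 0 else 1 / (real n * \<omega> n))" for n
  have f_nonneg: "0 \<le> f n" for n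
    using pos[of n] by (auto simp: f_def less_imp_le)
  have "summable f"
    using sum by (subst summable_Suc_iff[symmetric]) (simp add: f_def)
  moreover have "f (Suc m) \<le> f m" if "0 < m" for m
  proof -
    have "1 / (real (Suc m) * \<omega> (Suc m)) \<le> 1 / (real m * \<omega> m)"
      using that by (intro divide_left_mono mult_mono le mult_pos_pos pos less_imp_le[OF pos]) auto
    then show ?thesis using that by (simp add: f_def)
  qed
  ultimately have "summable (\<lambda>n. 2 ^ n * f (2 ^ n))"
    using condensation_test[of f] f_nonneg by blast
  \<comment> \<open>The condensation factor \<open>2 ^ n\<close> cancels the factor \<open>n\<close>
    of the denominator taken at \<open>2 ^ n\<close>.\<close>
  then have "summable (\<lambda>n. 1 / \<omega> (2 ^ n))"
    by (simp add: f_def)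
  moreover have "1 / \<omega> (2 ^ Suc m) \<le> 1 / \<omega> (2 ^ m)" for m
    by (intro dec) auto
  ultimately show ?thesis
    using condensation_test[of "\<lambda>n. 1 / \<omega> (2 ^ n)"] pos by (simp add: less_imp_le)
qed

section \<open>Exponential bounds for square integrable martingale differences\<close>

text \<open>By monotone convergence the sum has finite integral, hence is finite almost everywhere.
  Applied to weighted exponentials, this plays the role of the Borel-Cantelli lemma.\<close>

lemma AE_summable_nonneg:
  fixes u :: "nat \<Rightarrow> 'a \<Rightarrow> real"
  assumes int: "\<And>n. integrable M (u n)"
    and nonneg: "\<And>n. AE x in M. 0 \<le> u n x"
    and le: "\<And>n. (\<integral>x. u n x \<partial>M) \<le> s n"
    and sum: "summable s"
  shows "AE x in M. summable (\<lambda>n. u n x)"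
proof -
  have [measurable]: "u n \<in> borel_measurable M" for n
    using int by simp
  have "summable (\<lambda>n. \<integral>x. u n x \<partial>M)"
    using le nonneg by (intro summable_comparison_test'[OF sum]) (auto simp: integral_nonneg_AE)
  moreover have "(\<integral>\<^sup>+x. (\<Sum>n. ennreal (u n x)) \<partial>M) = (\<Sum>n. ennreal (\<integral>x. u n x \<partial>M))"
    using int nonneg by (simp add: nn_integral_suminf nn_integral_eq_integral)
  ultimately have "(\<integral>\<^sup>+x. (\<Sum>n. ennreal (u n x)) \<partial>M) \<noteq> \<infinity>"
    using nonneg by (simp add: ennreal_suminf_neq_top integral_nonneg_AE)
  then have "AE x in M. (\<Sum>n. ennreal (u n x)) \<noteq> \<infinity>"
    by (intro nn_integral_PInf_AE) auto
  moreover have "AE x in M. \<forall>n. 0 \<le> u n x"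
    using nonneg by (simp add: AE_all_countable)
  ultimately show ?thesis
    by eventually_elim (auto intro: summable_suminf_not_top)
qed

lemma (in finite_measure) integrable_mult_AE_bounded:
  fixes f g :: "'a \<Rightarrow> real"
  assumes "integrable M f" "g \<in> borel_measurable M" "AE x in M. \<bar>g x\<bar> \<le> C"
  shows "integrable M (\<lambda>x. g x * f x)"
proof (rule Bochner_Integration.integrable_bound[of _ "\<lambda>x. C * f x"])
  show "AE x in M. norm (g x * f x) \<le> norm (C * f x)"
    using assms(3) by eventually_elim (auto simp: abs_mult intro!: mult_right_mono)
qed (use assms in auto)

lemma (in finite_measure) integrable_product_of_squares:
  fixes f g :: "'a \<Rightarrow> real"
  assumes [measurable]: "f \<in> borel_measurable M" "g \<in> borel_measurable M"
    and "integrable M (\<lambda>x. (f x)\<^sup>2)" "integrable M (\<lambda>x. (g x)\<^sup>2)"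
  shows "integrable M (\<lambda>x. f x * g x)"
proof (rule Bochner_Integration.integrable_bound[of _ "\<lambda>x. (f x)\<^sup>2 + (g x)\<^sup>2"])
  have "\<bar>s * t\<bar> \<le> s\<^sup>2 + t\<^sup>2" for s t :: real
    using sum_squares_bound[of "\<bar>s\<bar>" "\<bar>t\<bar>"] abs_ge_zero[of "s * t"]
    unfolding abs_mult power2_abs by linarith
  then show "AE x in M. norm (f x * g x) \<le> norm ((f x)\<^sup>2 + (g x)\<^sup>2)"
    by (auto intro!: AE_I2 order_trans[OF _ abs_ge_self])
qed (use assms in auto)

text \<open>Exponential supermartingale step without any boundedness of the increment: the square of
  the increment and its conditional expectation together absorb the second-order term.\<close>

lemma (in finite_measure_subalgebra) integral_exp_increment_le:
  fixes d g :: "'a \<Rightarrow> real"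
  assumes d: "integrable M d" "integrable M (\<lambda>x. (d x)\<^sup>2)"
    and zero: "AE x in M. real_cond_exp M F d x = 0"
    and gF [measurable]: "g \<in> borel_measurable F"
    and bound: "AE x in M. 0 \<le> g x \<and> g x \<le> C"
  shows "(\<integral>x. g x * exp (b * d x - b\<^sup>2 / 2 * ((d x)\<^sup>2 + real_cond_exp M F (\<lambda>x. (d x)\<^sup>2) x)) \<partial>M)
    \<le> (\<integral>x. g x \<partial>M)"
proof -
  define e where "e = real_cond_exp M F (\<lambda>x. (d x)\<^sup>2)"
  have [measurable]: "e \<in> borel_measurable F"
    by (simp add: e_def)
  \<comment> \<open>The factor with \<open>e\<close> is measurable over \<open>F\<close> and joins
    the weight; what remains is \<open>exp (y - y^2 / 2)\<close> with
    \<open>y = b * d x\<close>.\<close>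
  define h where "h x = g x * exp (- (b\<^sup>2 / 2 * e x))" for x
  have hF [measurable]: "h \<in> borel_measurable F"
    unfolding h_def by measurable
  have hM [measurable]: "h \<in> borel_measurable M" and gM [measurable]: "g \<in> borel_measurable M"
    by (rule measurable_from_subalg[OF subalg hF], rule measurable_from_subalg[OF subalg gF])
  have [measurable]: "d \<in> borel_measurable M"
    using d by simp
  have e_nonneg: "AE x in M. 0 \<le> e x"
    unfolding e_def by (rule real_cond_exp_pos) auto
  have h_bound: "AE x in M. 0 \<le> h x \<and> h x \<le> C"
    using bound e_nonneg
  proof eventually_elim
    case (elim x)
    then have "h x \<le> g x * 1"
      unfolding h_def by (intro mult_left_mono) auto
    with elim show ?case by (simp add: h_def)
  qed
  then have h_abs: "AE x in M. \<bar>h x\<bar> \<le> C"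
    by eventually_elim auto
  have int_h: "integrable M h"
    using integrable_mult_AE_bounded[OF _ hM h_abs, of "\<lambda>_. 1"] by simp
  have "AE x in M. \<bar>g x\<bar> \<le> C"
    using bound by eventually_elim auto
  then have int_g: "integrable M g"
    using integrable_mult_AE_bounded[OF _ gM, of "\<lambda>_. 1"] by simp
  have int_hd: "integrable M (\<lambda>x. h x * d x)"
    by (rule integrable_mult_AE_bounded[OF d(1) hM h_abs])
  have int_hd2: "integrable M (\<lambda>x. h x * (d x)\<^sup>2)"
    by (rule integrable_mult_AE_bounded[OF d(2) hM h_abs])
  have "(\<integral>x. h x * d x \<partial>M) = (\<integral>x. h x * real_cond_exp M F d x \<partial>M)"
    by (rule real_cond_exp_intg(2)[symmetric]) (use int_hd in auto)
  also have "\<dots> = (\<integral>x. 0 \<partial>M)"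
    using zero by (intro integral_cong_AE) auto
  finally have hd: "(\<integral>x. h x * d x \<partial>M) = 0" by simp
  have int_he: "integrable M (\<lambda>x. h x * e x)"
    unfolding e_def by (rule real_cond_exp_intg(1)) (use int_hd2 in auto)
  have hd2: "(\<integral>x. h x * (d x)\<^sup>2 \<partial>M) = (\<integral>x. h x * e x \<partial>M)"
    unfolding e_def by (rule real_cond_exp_intg(2)[symmetric]) (use int_hd2 in auto)
  have "(\<integral>x. g x * exp (b * d x - b\<^sup>2 / 2 * ((d x)\<^sup>2 + e x)) \<partial>M)
      \<le> (\<integral>x. h x + b * (h x * d x) + b\<^sup>2 / 2 * (h x * (d x)\<^sup>2) \<partial>M)"
  proof (rule integral_mono_AE')
    show "integrable M (\<lambda>x. h x + b * (h x * d x) + b\<^sup>2 / 2 * (h x * (d x)\<^sup>2))"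
      using int_h int_hd int_hd2 by auto
    have eq: "g x * exp (b * d x - b\<^sup>2 / 2 * ((d x)\<^sup>2 + e x))
        = h x * exp (b * d x - (b * d x)\<^sup>2 / 2)" for x
      by (simp add: h_def mult.assoc flip: exp_add) (simp add: algebra_simps power_mult_distrib)
    have le: "g x * exp (b * d x - b\<^sup>2 / 2 * ((d x)\<^sup>2 + e x))
        \<le> h x + b * (h x * d x) + b\<^sup>2 / 2 * (h x * (d x)\<^sup>2)" if "0 \<le> h x" for x
      using mult_left_mono[OF exp_diff_half_square_le[of "b * d x"] that]
      unfolding eq by (simp add: algebra_simps power_mult_distrib)
    show "AE x in M. g x * exp (b * d x - b\<^sup>2 / 2 * ((d x)\<^sup>2 + e x))
        \<le> h x + b * (h x * d x) + b\<^sup>2 / 2 * (h x * (d x)\<^sup>2)"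
      using h_bound by eventually_elim (blast intro: le)
    \<comment> \<open>This form of monotonicity asks for a nonnegative majorant in place of
      integrability of the left-hand side.\<close>
    show "AE x in M. 0 \<le> h x + b * (h x * d x) + b\<^sup>2 / 2 * (h x * (d x)\<^sup>2)"
      using h_bound bound
    proof eventually_elim
      case (elim x)
      then have "0 \<le> g x * exp (b * d x - b\<^sup>2 / 2 * ((d x)\<^sup>2 + e x))" by simp
      also have "\<dots> \<le> h x + b * (h x * d x) + b\<^sup>2 / 2 * (h x * (d x)\<^sup>2)"
        using elim by (intro le) simp
      finally show ?case .
    qed
  qed
  also have "\<dots> = (\<integral>x. h x + b\<^sup>2 / 2 * (h x * e x) \<partial>M)"
    using int_h int_hd int_hd2 int_he by (simp add: hd hd2)
  also have "\<dots> \<le> (\<integral>x. g x \<partial>M)"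
  proof (rule integral_mono_AE)
    show "AE x in M. h x + b\<^sup>2 / 2 * (h x * e x) \<le> g x"
      using bound
    proof eventually_elim
      case (elim x)
      \<comment> \<open>The inequality \<open>1 + t \<le> exp t\<close> at
        \<open>t = b^2 / 2 * e x\<close> is compensated exactly by the factor put into
        \<open>h\<close>.\<close>
      have "(1 + b\<^sup>2 / 2 * e x) * exp (- (b\<^sup>2 / 2 * e x))
          \<le> exp (b\<^sup>2 / 2 * e x) * exp (- (b\<^sup>2 / 2 * e x))"
        by (intro mult_right_mono exp_ge_add_one_self) auto
      then have "g x * ((1 + b\<^sup>2 / 2 * e x) * exp (- (b\<^sup>2 / 2 * e x))) \<le> g x * 1"
        using elim by (intro mult_left_mono) (auto simp flip: exp_add)
      then show ?case by (simp add: h_def algebra_simps)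
    qed
  qed (use int_h int_he int_g in auto)
  finally show ?thesis by (simp add: e_def)
qed

lemma (in finite_measure_subalgebra) real_cond_exp_sum_finite:
  fixes f :: "'b \<Rightarrow> 'a \<Rightarrow> real"
  assumes "\<And>i. i \<in> I \<Longrightarrow> integrable M (f i)"
  shows "AE x in M. real_cond_exp M F (\<lambda>x. \<Sum>i\<in>I. f i x) x = (\<Sum>i\<in>I. real_cond_exp M F (f i) x)"
proof -
  \<comment> \<open>Extension by zero makes every member of the family integrable, also for indices
    outside \<open>I\<close>.\<close>
  define h where "h i = (if i \<in> I then f i else (\<lambda>_. 0))" for i
  have "integrable M (h i)" for i
    using assms by (simp add: h_def)
  then have "AE x in M. real_cond_exp M F (\<lambda>x. \<Sum>i\<in>I. h i x) x = (\<Sum>i\<in>I. real_cond_exp M F (h i) x)"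
    by (rule real_cond_exp_sum)
  then show ?thesis by (simp add: h_def cong: sum.cong)
qed

section \<open>Martingale differences on a probability space and their exponential process\<close>

locale martingale_differences = prob_space M for M :: "'a measure" +
  fixes F :: "nat \<Rightarrow> 'a measure" and d :: "nat \<Rightarrow> 'a \<Rightarrow> real"
  assumes subalgebra: "subalgebra M (F n)"
    and subalgebra_mono: "m \<le> n \<Longrightarrow> subalgebra (F n) (F m)"
    and adapted: "1 \<le> n \<Longrightarrow> d n \<in> borel_measurable (F n)"
    and integrable: "1 \<le> n \<Longrightarrow> integrable M (d n)"
    and cond_exp_zero: "2 \<le> n \<Longrightarrow> AE x in M. real_cond_exp M (F (n - 1)) (d n) x = 0"
begin

lemma finite_measure_subalgebra: "finite_measure_subalgebra M (F n)"
  by (intro finite_measure_subalgebra.intro finite_measure_axioms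
      finite_measure_subalgebra_axioms.intro subalgebra)

lemma measurable_mono:
  assumes "m \<le> n" "g \<in> borel_measurable (F m)"
  shows "g \<in> borel_measurable (F n)"
  by (rule measurable_from_subalg[OF subalgebra_mono[OF assms(1)] assms(2)])

lemma measurable_M: "g \<in> borel_measurable (F n) \<Longrightarrow> g \<in> borel_measurable M"
  by (rule measurable_from_subalg[OF subalgebra])

lemma cond_exp_past:
  assumes "1 \<le> j" "j \<le> n"
  shows "AE x in M. real_cond_exp M (F n) (d j) x = d j x"
proof -
  interpret S: finite_measure_subalgebra M "F n"
    by (rule finite_measure_subalgebra)
  show ?thesis
    by (rule S.real_cond_exp_F_meas)
      (use assms integrable adapted measurable_mono[of j n] in auto)
qed

text \<open>Tower property: conditioning on \<open>F (j - 1)\<close> first already gives zero. The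
  case \<open>n = 0\<close>, \<open>j = 1\<close> is excluded because \<open>d 1\<close> need not be
  centred.\<close>

lemma cond_exp_future:
  assumes "1 \<le> n" "n < j"
  shows "AE x in M. real_cond_exp M (F n) (d j) x = 0"
proof -
  interpret S: finite_measure_subalgebra M "F n"
    by (rule finite_measure_subalgebra)
  have int: "integrable M (d j)"
    using assms integrable by simp
  have "AE x in M. real_cond_exp M (F n) (real_cond_exp M (F (j - 1)) (d j)) x
      = real_cond_exp M (F n) (d j) x"
    by (rule S.real_cond_exp_nested_subalg)
      (use assms subalgebra subalgebra_mono[of n "j - 1"] int in auto)
  moreover have "AE x in M. real_cond_exp M (F n) (real_cond_exp M (F (j - 1)) (d j)) x
      = real_cond_exp M (F n) (\<lambda>_. 0) x"
    by (rule S.real_cond_exp_cong) (use assms cond_exp_zero[of j] in auto)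
  moreover have "AE x in M. real_cond_exp M (F n) (\<lambda>_. 0) x = 0"
    by (rule S.real_cond_exp_F_meas) auto
  ultimately show ?thesis by eventually_elim simp
qed

text \<open>Conditioning truncates the combination: past terms are measurable and future ones
  vanish.\<close>

lemma cond_exp_combination:
  assumes "finite I" "I \<subseteq> {1..}" "1 \<le> n"
  shows "AE x in M. real_cond_exp M (F n) (\<lambda>x. \<Sum>j\<in>I. c j * d j x) x
    = (\<Sum>j | j \<in> I \<and> j \<le> n. c j * d j x)"
proof -
  interpret S: finite_measure_subalgebra M "F n"
    by (rule finite_measure_subalgebra)
  have "AE x in M. real_cond_exp M (F n) (\<lambda>x. \<Sum>j\<in>I. c j * d j x) x
      = (\<Sum>j\<in>I. real_cond_exp M (F n) (\<lambda>x. c j * d j x) x)"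
    by (rule S.real_cond_exp_sum_finite) (use assms integrable in auto)
  moreover have "AE x in M. \<forall>j\<in>I. real_cond_exp M (F n) (\<lambda>x. c j * d j x) x
      = (if j \<le> n then c j * d j x else 0)"
  proof (rule AE_finite_allI[OF assms(1)])
    fix j assume "j \<in> I"
    then have j: "1 \<le> j" using assms by auto
    have "AE x in M. real_cond_exp M (F n) (d j) x = (if j \<le> n then d j x else 0)"
      using cond_exp_past[of j n] cond_exp_future[of n j] j assms by (cases "j \<le> n") auto
    with S.real_cond_exp_cmult[OF integrable[OF j], of "c j"]
    show "AE x in M. real_cond_exp M (F n) (\<lambda>x. c j * d j x) x
      = (if j \<le> n then c j * d j x else 0)"
      by eventually_elim simp
  qed
  ultimately show ?thesis
  proof eventually_elim
    case (elim x)
    then have "real_cond_exp M (F n) (\<lambda>x. \<Sum>j\<in>I. c j * d j x) x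
        = (\<Sum>j\<in>I. if j \<le> n then c j * d j x else 0)"
      by simp
    with assms(1) show ?case by (simp add: sum.inter_filter)
  qed
qed

text \<open>The \<open>j\<close>-th term is the difference of the conditional expectations of the combination at the
  levels \<open>j\<close> and \<open>j - 1\<close>, and these are square integrable by Jensen's inequality.\<close>

lemma square_integrable_term:
  assumes I: "finite I" "I \<subseteq> {1..}" "j \<in> I"
    and sq: "integrable M (\<lambda>x. (\<Sum>j\<in>I. c j * d j x)\<^sup>2)"
  shows "integrable M (\<lambda>x. (c j * d j x)\<^sup>2)"
proof -
  define P where "P n x = (\<Sum>j | j \<in> I \<and> j \<le> n. c j * d j x)" for n x
  have d_meas [measurable]: "d j \<in> borel_measurable M" if "j \<in> I" for j
    using that I integrable by fastforce
  have P_meas [measurable]: "P n \<in> borel_measurable M" for n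
    unfolding P_def by (intro borel_measurable_sum) auto
  have P_sq: "integrable M (\<lambda>x. (P n x)\<^sup>2)" for n
  \<comment> \<open>Level 0 gives the empty sum, since indices start at 1; the truncation by
    conditioning is available from level 1 on.\<close>
  proof (cases "n = 0")
    case True
    then have "P n x = 0" for x
      unfolding P_def using I by (intro sum.neutral) auto
    then show ?thesis by simp
  next
    case False
    interpret S: finite_measure_subalgebra M "F n"
      by (rule finite_measure_subalgebra)
    have "integrable M (\<lambda>x. (real_cond_exp M (F n) (\<lambda>x. \<Sum>j\<in>I. c j * d j x) x)\<^sup>2)"
    proof (rule S.integrable_convex_cond_exp[where I = UNIV and q = "\<lambda>t. t\<^sup>2"])
      show "integrable M (\<lambda>x. \<Sum>j\<in>I. c j * d j x)"
        using I integrable by (auto intro!: Bochner_Integration.integrable_sum)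
      show "convex_on UNIV (\<lambda>t :: real. t\<^sup>2)"
        by (rule convex_power2)
    qed (use sq in auto)
    then show ?thesis
    proof (rule integrable_cong_AE_imp)
      show "AE x in M. (real_cond_exp M (F n) (\<lambda>x. \<Sum>j\<in>I. c j * d j x) x)\<^sup>2 = (P n x)\<^sup>2"
        using cond_exp_combination[of I n c] I False by (auto simp: P_def)
    qed simp
  qed
  have "c j * d j x = P j x - P (j - 1) x" for x
  proof -
    have "{i. i \<in> I \<and> i \<le> j} = insert j {i. i \<in> I \<and> i \<le> j - 1}"
      using I by auto
    moreover have "j \<notin> {i. i \<in> I \<and> i \<le> j - 1}"
      using I by auto
    ultimately show ?thesis
      using I by (simp add: P_def)
  qed
  then have "(c j * d j x)\<^sup>2 = (P j x)\<^sup>2 + (P (j - 1) x)\<^sup>2 - 2 * (P j x * P (j - 1) x)" for x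
    by (simp add: power2_diff)
  then show ?thesis
    using P_sq by (auto intro!: Bochner_Integration.integrable_diff
        Bochner_Integration.integrable_add integrable_mult_right integrable_product_of_squares)
qed

end

text \<open>Square integrability is kept apart because the given functions are only integrable; for
  terms of a square integrable combination it is derived by
  \<open>square_integrable_term\<close>.\<close>

locale square_integrable_martingale_differences = martingale_differences +
  assumes square_integrable: "1 \<le> n \<Longrightarrow> integrable M (\<lambda>x. (d n x)\<^sup>2)"
begin

text \<open>The earlier factor is measurable over \<open>F (j - 1)\<close>, so the later one may be
  replaced by its conditional expectation, which is zero.\<close>

lemma orthogonal:
  assumes "1 \<le> i" "1 \<le> j" "i \<noteq> j"
  shows "(\<integral>x. d i x * d j x \<partial>M) = 0"
proof -
  have less: "(\<integral>x. d i x * d j x \<partial>M) = 0" if "1 \<le> i" "i < j" for i j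
  proof -
    interpret S: finite_measure_subalgebra M "F (j - 1)"
      by (rule finite_measure_subalgebra)
    have [measurable]: "d i \<in> borel_measurable M" "d j \<in> borel_measurable M"
      using that integrable[of i] integrable[of j] by auto
    have "(\<integral>x. d i x * d j x \<partial>M) = (\<integral>x. d i x * real_cond_exp M (F (j - 1)) (d j) x \<partial>M)"
    proof (rule S.real_cond_exp_intg(2)[symmetric])
      show "integrable M (\<lambda>x. d i x * d j x)"
        using that by (intro integrable_product_of_squares square_integrable) auto
      show "d i \<in> borel_measurable (F (j - 1))"
        using that by (intro measurable_mono[of i "j - 1"] adapted) auto
    qed simp
    also have "\<dots> = (\<integral>x. 0 \<partial>M)"
      using cond_exp_zero[of j] that by (intro integral_cong_AE) auto
    finally show ?thesis by simp
  qed
  show ?thesis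
    using less[of i j] less[of j i] assms by (cases i j rule: linorder_cases) (auto simp: mult.commute)
qed

lemma integrable_mult: "1 \<le> i \<Longrightarrow> 1 \<le> j \<Longrightarrow> integrable M (\<lambda>x. d i x * d j x)"
  by (intro integrable_product_of_squares square_integrable borel_measurable_integrable integrable)

text \<open>Only the diagonal survives. Disjoint sets give the orthogonality of the polynomials,
  equal sets their norms.\<close>

lemma integral_mult_sums:
  assumes I: "finite I" "I \<subseteq> {1..}" and J: "finite J" "J \<subseteq> {1..}"
  shows "(\<integral>x. (\<Sum>i\<in>I. d i x) * (\<Sum>j\<in>J. d j x) \<partial>M) = (\<Sum>i\<in>I \<inter> J. \<integral>x. (d i x)\<^sup>2 \<partial>M)"
proof -
  have "(\<integral>x. (\<Sum>i\<in>I. d i x) * (\<Sum>j\<in>J. d j x) \<partial>M)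
      = (\<Sum>i\<in>I. \<Sum>j\<in>J. \<integral>x. d i x * d j x \<partial>M)"
    unfolding sum_product using I J
    by (subst Bochner_Integration.integral_sum) (auto intro!: sum.cong integrable_mult
        Bochner_Integration.integrable_sum Bochner_Integration.integral_sum)
  also have "\<dots> = (\<Sum>i\<in>I. \<Sum>j\<in>J. if i = j then \<integral>x. (d i x)\<^sup>2 \<partial>M else 0)"
    using I J orthogonal by (intro sum.cong) (auto simp: power2_eq_square subset_eq)
  also have "\<dots> = (\<Sum>i\<in>I \<inter> J. \<integral>x. (d i x)\<^sup>2 \<partial>M)"
    using I J by (simp add: sum.inter_restrict)
  finally show ?thesis .
qed

text \<open>For \<open>n = 1\<close> the conditioning is on \<open>F 0\<close>, over which \<open>d 1\<close> need not have mean zero. This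
  costs the factor \<open>exp (1 / 2)\<close> in \<open>integral_exp_process\<close>.\<close>

definition bracket :: "nat \<Rightarrow> 'a \<Rightarrow> real" where
  "bracket n x = (d n x)\<^sup>2 + real_cond_exp M (F (n - 1)) (\<lambda>x. (d n x)\<^sup>2) x"

lemma bracket_measurable: "1 \<le> n \<Longrightarrow> bracket n \<in> borel_measurable (F n)"
  unfolding bracket_def
  by (intro borel_measurable_add borel_measurable_power adapted
      measurable_mono[of "n - 1" n] borel_measurable_cond_exp) auto

lemma cond_exp_square_nonneg:
  assumes "1 \<le> n"
  shows "AE x in M. 0 \<le> real_cond_exp M (F (n - 1)) (\<lambda>x. (d n x)\<^sup>2) x"
proof -
  interpret S: finite_measure_subalgebra M "F (n - 1)"
    by (rule finite_measure_subalgebra)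
  show ?thesis
    by (rule S.real_cond_exp_pos) (use assms integrable[of n] in auto)
qed

lemma square_le_bracket:
  assumes "1 \<le> n"
  shows "AE x in M. (d n x)\<^sup>2 \<le> bracket n x"
  using cond_exp_square_nonneg[OF assms] by eventually_elim (simp add: bracket_def)

lemma integral_bracket:
  assumes "1 \<le> n"
  shows "integrable M (bracket n)" "(\<integral>x. bracket n x \<partial>M) = 2 * (\<integral>x. (d n x)\<^sup>2 \<partial>M)"
proof -
  interpret S: finite_measure_subalgebra M "F (n - 1)"
    by (rule finite_measure_subalgebra)
  note sq = square_integrable[OF assms]
  show "integrable M (bracket n)"
    unfolding bracket_def using sq S.real_cond_exp_int(1)[OF sq] by auto
  show "(\<integral>x. bracket n x \<partial>M) = 2 * (\<integral>x. (d n x)\<^sup>2 \<partial>M)"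
    unfolding bracket_def using sq S.real_cond_exp_int[OF sq] by simp
qed

text \<open>The coefficient may vary with the index, so that several polynomials with different
  coefficients fit into one process.\<close>

definition exp_process :: "(nat \<Rightarrow> real) \<Rightarrow> nat set \<Rightarrow> 'a \<Rightarrow> real" where
  "exp_process b D x = exp (\<Sum>j\<in>D. b j * d j x - (b j)\<^sup>2 / 2 * bracket j x)"

lemma exp_process_measurable:
  assumes "D \<subseteq> {1..n}"
  shows "exp_process b D \<in> borel_measurable (F n)"
proof -
  have "(\<lambda>x. b j * d j x - (b j)\<^sup>2 / 2 * bracket j x) \<in> borel_measurable (F n)" if "j \<in> D" for j
  proof -
    have "1 \<le> j" "j \<le> n" using that assms by auto
    then have [measurable]: "d j \<in> borel_measurable (F n)" "bracket j \<in> borel_measurable (F n)"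
      using measurable_mono[OF _ adapted] measurable_mono[OF _ bracket_measurable] by auto
    show ?thesis by measurable
  qed
  then have [measurable]: "(\<lambda>x. \<Sum>j\<in>D. b j * d j x - (b j)\<^sup>2 / 2 * bracket j x) \<in> borel_measurable (F n)"
    by (rule borel_measurable_sum)
  show ?thesis unfolding exp_process_def by measurable
qed

text \<open>Completing the square bounds each summand of the exponent by \<open>1 / 2\<close>. The
  bound grows with \<open>D\<close>; it supplies integrability, the boundedness in the increment
  step, and the case of the single index 1.\<close>

lemma exp_process_le:
  assumes "finite D" "D \<subseteq> {1..}"
  shows "AE x in M. exp_process b D x \<le> exp (card D / 2)"
proof -
  have "AE x in M. \<forall>j\<in>D. (d j x)\<^sup>2 \<le> bracket j x"
    using assms square_le_bracket by (intro AE_finite_allI) auto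
  then show ?thesis
  proof eventually_elim
    case (elim x)
    have "b j * d j x - (b j)\<^sup>2 / 2 * bracket j x \<le> 1 / 2" if "j \<in> D" for j
    proof -
      have "b j * d j x - (b j)\<^sup>2 / 2 * bracket j x \<le> b j * d j x - (b j)\<^sup>2 / 2 * (d j x)\<^sup>2"
        using elim that by (intro diff_left_mono mult_left_mono) auto
      also have "\<dots> = 1 / 2 - (b j * d j x - 1)\<^sup>2 / 2"
        by (simp add: power2_eq_square field_simps)
      also have "\<dots> \<le> 1 / 2" by simp
      finally show ?thesis .
    qed
    from sum_bounded_above[OF this] show ?case
      by (simp add: exp_process_def)
  qed
qed

text \<open>The largest index is split off; the process over the smaller ones is measurable one
  level below it, so the increment step shows that the integral does not grow.\<close>

lemma integral_exp_process:
  assumes "finite D" "D \<subseteq> {1..}"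
  shows "integrable M (exp_process b D)" "(\<integral>x. exp_process b D x \<partial>M) \<le> 2"
proof -
  have int: "integrable M (exp_process b D)" if D: "finite D" "D \<subseteq> {1..}" for D
  proof -
    obtain n where "\<forall>j\<in>D. j \<le> n"
      using D finite_nat_set_iff_bounded_le by blast
    with D have [measurable]: "exp_process b D \<in> borel_measurable M"
      by (intro measurable_M[OF exp_process_measurable[of D n]]) (auto simp: subset_eq)
    have "AE x in M. \<bar>exp_process b D x\<bar> \<le> exp (card D / 2)"
      using exp_process_le[OF D] by eventually_elim (simp add: exp_process_def)
    from integrable_mult_AE_bounded[OF _ _ this, of "\<lambda>_. 1"] show ?thesis by simp
  qed
  then show "integrable M (exp_process b D)" using assms by blast
  show "(\<integral>x. exp_process b D x \<partial>M) \<le> 2"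
    using assms
  proof (induction D rule: finite_linorder_max_induct)
    case empty
    then show ?case by (simp add: exp_process_def prob_space)
  next
    case (insert n D)
    show ?case
    \<comment> \<open>Index 1 can be the largest only if \<open>D\<close> is empty. Without a
      centred increment the pointwise bound \<open>exp (1 / 2)\<close> takes over, hence the
      constant 2.\<close>
    proof (cases "n = 1")
      case True
      with insert have [simp]: "D = {}" by fastforce
      have "exp (1 / 2 :: real) \<le> 2"
      proof -
        have "exp (1 / 2 :: real) \<le> 1 + 1 / 2 + (1 / 2)\<^sup>2"
          by (rule exp_bound) auto
        then show ?thesis by (simp add: power2_eq_square)
      qed
      moreover have "AE x in M. exp_process b {n} x \<le> exp (1 / 2)"
        using exp_process_le[of "{n}" b] True by simp
      then have "(\<integral>x. exp_process b {n} x \<partial>M) \<le> (\<integral>x. exp (1 / 2) \<partial>M)"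
        using int[of "{n}"] True by (intro integral_mono_AE) auto
      ultimately show ?thesis by (simp add: prob_space)
    next
      case False
      then have n: "2 \<le> n" using insert by auto
      interpret S: finite_measure_subalgebra M "F (n - 1)"
        by (rule finite_measure_subalgebra)
      have D: "D \<subseteq> {1..n - 1}"
        using insert by fastforce
      have "n \<notin> D" using insert by auto
      then have "exp_process b (insert n D) x
          = exp_process b D x * exp (b n * d n x - (b n)\<^sup>2 / 2 *
              ((d n x)\<^sup>2 + real_cond_exp M (F (n - 1)) (\<lambda>x. (d n x)\<^sup>2) x))" for x
        using insert by (simp add: exp_process_def bracket_def exp_add mult.commute)
      then have "(\<integral>x. exp_process b (insert n D) x \<partial>M)
          = (\<integral>x. exp_process b D x * exp (b n * d n x - (b n)\<^sup>2 / 2 *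
              ((d n x)\<^sup>2 + real_cond_exp M (F (n - 1)) (\<lambda>x. (d n x)\<^sup>2) x)) \<partial>M)"
        by simp
      also have "\<dots> \<le> (\<integral>x. exp_process b D x \<partial>M)"
      proof (rule S.integral_exp_increment_le)
        show "AE x in M. 0 \<le> exp_process b D x \<and> exp_process b D x \<le> exp (card D / 2)"
          using exp_process_le[of D b] insert D by (auto simp: exp_process_def)
      qed (use n integrable square_integrable cond_exp_zero exp_process_measurable[OF D] in auto)
      also have "\<dots> \<le> 2" using insert by auto
      finally show ?thesis .
    qed
  qed
qed

end

section \<open>Self-normalized systems\<close>

text \<open>The random variable \<open>V n\<close> acts as a variance proxy of \<open>q n\<close>: sums of the \<open>q n\<close> are
  subgaussian after normalisation by the corresponding sums of the \<open>V n\<close>.\<close>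

locale self_normalized_system = prob_space M for M :: "'a measure" +
  fixes q V :: "nat \<Rightarrow> 'a \<Rightarrow> real"
  assumes proxy_integrable: "1 \<le> n \<Longrightarrow> integrable M (V n)"
    and proxy_nonneg: "1 \<le> n \<Longrightarrow> AE x in M. 0 \<le> V n x"
    and proxy_integral: "1 \<le> n \<Longrightarrow> (\<integral>x. V n x \<partial>M) \<le> 2"
    and exp_integrable: "finite B \<Longrightarrow> B \<subseteq> {1..} \<Longrightarrow>
      integrable M (\<lambda>x. exp (\<Sum>n\<in>B. b n * q n x - (b n)\<^sup>2 / 2 * V n x))"
    and exp_integral: "finite B \<Longrightarrow> B \<subseteq> {1..} \<Longrightarrow>
      (\<integral>x. exp (\<Sum>n\<in>B. b n * q n x - (b n)\<^sup>2 / 2 * V n x) \<partial>M) \<le> 2"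
begin

text \<open>Here \<open>\<kappa>\<close> assigns indices to blocks, and \<open>l k\<close> is both a
  lower bound for \<open>\<omega>\<close> on the block and the exponential parameter. Dividing the
  exponent bound by \<open>l k\<close> balances the entropy term \<open>2 ^ k / l k\<close> against
  the variance term with \<open>l k * W\<close>.\<close>

theorem rearrangement_converges_AE:
  fixes \<sigma> \<kappa> :: "nat \<Rightarrow> nat" and a l \<omega> :: "nat \<Rightarrow> real"
  assumes \<sigma>: "bij_betw \<sigma> {1..} {1..}"
    and \<kappa>: "\<And>n. 1 \<le> n \<Longrightarrow> n < 4 ^ 2 ^ \<kappa> n"
    and l_pos: "\<And>k. 0 < l k"
    and l_le: "\<And>n. 1 \<le> n \<Longrightarrow> l (\<kappa> n) \<le> \<omega> n"
    and l_sum: "summable (\<lambda>k. 2 ^ k / l k)"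
    and a_sum: "summable (\<lambda>i. (a (Suc i))\<^sup>2 * \<omega> (Suc i))"
  shows "AE x in M. summable (\<lambda>i. a (\<sigma> (Suc i)) * q (\<sigma> (Suc i)) x)"
proof -
  define \<Delta> where "\<Delta> k = {n. 1 \<le> n \<and> \<kappa> n = k}" for k
  have \<Delta>_sub: "\<Delta> k \<subseteq> {1..<4 ^ 2 ^ k}" for k
    using \<kappa> by (auto simp: \<Delta>_def)
  have fin: "finite (\<Delta> k)" for k
    by (rule finite_subset[OF \<Delta>_sub]) simp
  \<comment> \<open>The members of \<open>C k\<close> are the traces of the initial segments of the
    rearrangement on the block; they form a chain.\<close>
  define C where "C k = range (\<lambda>m. {n. n \<in> \<sigma> ` {1..m} \<and> \<kappa> n = k})" for k
  have C_sub: "C k \<subseteq> Pow (\<Delta> k)" for k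
  proof -
    have "\<sigma> ` {1..m} \<subseteq> {1..}" for m
      using image_mono[of "{1..m}" "{1..}" \<sigma>] bij_betw_imp_surj_on[OF \<sigma>] by auto
    then show ?thesis
      unfolding C_def \<Delta>_def by fastforce
  qed
  have C_fin: "finite (C k)" for k
    by (rule finite_subset[OF C_sub]) (simp add: fin)
  have C_card: "real (card (C k)) \<le> 4 ^ 2 ^ k" for k
  proof -
    have "A \<subseteq> B \<or> B \<subseteq> A" if AB: "A \<in> C k" "B \<in> C k" for A B
    proof -
      obtain i j where "A = {n. n \<in> \<sigma> ` {1..i} \<and> \<kappa> n = k}" "B = {n. n \<in> \<sigma> ` {1..j} \<and> \<kappa> n = k}"
        using AB unfolding C_def by blast
      moreover have "\<sigma> ` {1..i} \<subseteq> \<sigma> ` {1..j} \<or> \<sigma> ` {1..j} \<subseteq> \<sigma> ` {1..i}"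
        using nat_le_linear[of i j] by (auto intro!: image_mono)
      ultimately show ?thesis by blast
    qed
    from card_chain_le[OF fin C_sub this] have "card (C k) \<le> Suc (card (\<Delta> k))"
      by blast
    \<comment> \<open>The interval omits 0, which makes room for the \<open>Suc\<close> of the chain
      bound.\<close>
    also have "card (\<Delta> k) \<le> card {1..<4 ^ 2 ^ k :: nat}"
      by (rule card_mono[OF _ \<Delta>_sub]) simp
    finally have "card (C k) \<le> 4 ^ 2 ^ k" by simp
    then show ?thesis
      by (metis of_nat_le_iff of_nat_numeral of_nat_power)
  qed
  define S where "S B x = (\<Sum>n\<in>B. a n * q n x)" for B x
  define W where "W B x = (\<Sum>n\<in>B. (a n)\<^sup>2 * V n x)" for B x
  define Y where "Y k s B x = exp (s * l k * S B x - (l k)\<^sup>2 / 2 * W B x)" for k s B x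
  have Y: "integrable M (Y k s B)" "(\<integral>x. Y k s B x \<partial>M) \<le> 2"
    if "B \<in> C k" "\<bar>s\<bar> = 1" for k B and s :: real
  proof -
    have "finite B" "B \<subseteq> {1..}"
      using that C_sub[of k] fin[of k] finite_subset by (auto simp: \<Delta>_def)
    moreover have "s\<^sup>2 = 1"
      using that by (metis power2_abs one_power2)
    then have "Y k s B = (\<lambda>x. exp (\<Sum>n\<in>B. (s * l k * a n) * q n x - (s * l k * a n)\<^sup>2 / 2 * V n x))"
      by (simp add: Y_def S_def W_def fun_eq_iff sum_subtractf sum_distrib_left power_mult_distrib
          mult_ac)
    ultimately show "integrable M (Y k s B)" "(\<integral>x. Y k s B x \<partial>M) \<le> 2"
      using exp_integrable exp_integral by simp_all
  qed
  \<comment> \<open>Once \<open>H k x\<close> is below 1, each exponential of the block, for either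
    sign, is below \<open>exp (3 * 2 ^ k)\<close>; this is the union bound in integrated
    form.\<close>
  define H where "H k x = exp (- 3 * 2 ^ k) * (\<Sum>B\<in>C k. Y k 1 B x + Y k (-1) B x)" for k x
  have "AE x in M. summable (\<lambda>k. H k x)"
  proof (rule AE_summable_nonneg)
    show "integrable M (H k)" for k
      unfolding H_def using Y by (auto intro!: Bochner_Integration.integrable_sum)
    show "AE x in M. 0 \<le> H k x" for k
      by (auto simp: H_def Y_def intro!: mult_nonneg_nonneg sum_nonneg add_nonneg_nonneg)
    show "(\<integral>x. H k x \<partial>M) \<le> 4 * (1 / 2) ^ k" for k
    proof -
      have "(\<integral>x. H k x \<partial>M)
          = exp (- 3 * 2 ^ k) * (\<Sum>B\<in>C k. (\<integral>x. Y k 1 B x \<partial>M) + (\<integral>x. Y k (-1) B x \<partial>M))"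
        unfolding H_def using Y by (simp add: Bochner_Integration.integral_sum)
      also have "\<dots> \<le> exp (- 3 * 2 ^ k) * (\<Sum>B\<in>C k. 4)"
      proof (intro mult_left_mono sum_mono)
        fix B assume "B \<in> C k"
        then show "(\<integral>x. Y k 1 B x \<partial>M) + (\<integral>x. Y k (-1) B x \<partial>M) \<le> 4"
          using Y(2)[of B k 1] Y(2)[of B k "-1"] by simp
      qed simp
      also have "\<dots> \<le> exp (- 3 * 2 ^ k) * (4 ^ 2 ^ k * 4)"
        using C_card[of k] by (intro mult_left_mono) auto
      also have "\<dots> = 4 * (exp (- 3) * 4) ^ 2 ^ k"
        by (simp add: power_mult_distrib flip: exp_of_nat_mult)
      \<comment> \<open>The constant 3 is chosen so that \<open>exp 3 \<ge> 8\<close> beats the base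
        4 of the number of partial sums.\<close>
      also have "(exp (- 3) * 4 :: real) \<le> 1 / 2"
      proof -
        have "(2 :: real) ^ 3 \<le> exp 1 ^ 3"
          using exp_ge_add_one_self[of 1] by (intro power_mono) auto
        also have "exp 1 ^ 3 = exp (3 :: real)"
          by (simp flip: exp_of_nat_mult)
        finally show ?thesis
          by (simp add: exp_minus field_simps)
      qed
      then have "4 * (exp (- 3) * 4 :: real) ^ 2 ^ k \<le> 4 * (1 / 2) ^ 2 ^ k"
        by (intro mult_left_mono power_mono) auto
      also have "\<dots> \<le> 4 * (1 / 2 :: real) ^ k"
        using less_exp[of k] by (intro mult_left_mono power_decreasing) auto
      finally show ?thesis .
    qed
    show "summable (\<lambda>k. 4 * (1 / 2 :: real) ^ k)"
      by (intro summable_mult summable_geometric) simp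
  qed
  moreover have "AE x in M. summable (\<lambda>k. l k * W (\<Delta> k) x)"
  proof (rule AE_summable_nonneg)
    show "integrable M (\<lambda>x. l k * W (\<Delta> k) x)" for k
      unfolding W_def using proxy_integrable
      by (auto intro!: Bochner_Integration.integrable_sum simp: \<Delta>_def)
    show "AE x in M. 0 \<le> l k * W (\<Delta> k) x" for k
    proof -
      have "AE x in M. \<forall>n\<in>\<Delta> k. 0 \<le> V n x"
        using proxy_nonneg fin by (intro AE_finite_allI) (auto simp: \<Delta>_def)
      then show ?thesis
        by eventually_elim (use l_pos[of k] in \<open>auto simp: W_def intro!: mult_nonneg_nonneg sum_nonneg\<close>)
    qed
    show "(\<integral>x. l k * W (\<Delta> k) x \<partial>M) \<le> (\<Sum>n | 1 \<le> n \<and> \<kappa> n = k. 2 * ((a n)\<^sup>2 * \<omega> n))" for k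
    proof -
      have "(\<integral>x. l k * W (\<Delta> k) x \<partial>M) = (\<Sum>n\<in>\<Delta> k. l k * ((a n)\<^sup>2 * (\<integral>x. V n x \<partial>M)))"
        unfolding W_def using proxy_integrable
        by (simp add: \<Delta>_def Bochner_Integration.integral_sum sum_distrib_left)
      also have "\<dots> \<le> (\<Sum>n\<in>\<Delta> k. 2 * ((a n)\<^sup>2 * \<omega> n))"
      proof (rule sum_mono)
        fix n assume "n \<in> \<Delta> k"
        then have n: "1 \<le> n" "\<kappa> n = k" by (auto simp: \<Delta>_def)
        have "l k * ((a n)\<^sup>2 * (\<integral>x. V n x \<partial>M)) \<le> l k * ((a n)\<^sup>2 * 2)"
          using l_pos[of k] proxy_integral[OF n(1)] by (intro mult_left_mono) auto
        also have "\<dots> \<le> \<omega> n * ((a n)\<^sup>2 * 2)"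
          using l_le[OF n(1)] n(2) by (intro mult_right_mono) auto
        finally show "l k * ((a n)\<^sup>2 * (\<integral>x. V n x \<partial>M)) \<le> 2 * ((a n)\<^sup>2 * \<omega> n)"
          by (simp add: mult_ac)
      qed
      finally show ?thesis by (simp add: \<Delta>_def)
    qed
    show "summable (\<lambda>k. \<Sum>n | 1 \<le> n \<and> \<kappa> n = k. 2 * ((a n)\<^sup>2 * \<omega> n))"
    proof (rule summable_sum_fibres)
      show "0 \<le> 2 * ((a n)\<^sup>2 * \<omega> n)" if "1 \<le> n" for n
        using l_le[OF that] l_pos[of "\<kappa> n"] by simp
    qed (use fin a_sum in \<open>auto simp: \<Delta>_def intro: summable_mult\<close>)
  qed
  moreover have "AE x in M. \<forall>n. 1 \<le> n \<longrightarrow> 0 \<le> V n x"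
    using proxy_nonneg by (simp add: AE_all_countable)
  ultimately show ?thesis
  proof eventually_elim
    case (elim x)
    show ?case
    proof (rule summable_rearranged_blocks[OF \<sigma>, of \<kappa> "\<lambda>n. a n * q n x"])
      show "finite {n. 1 \<le> n \<and> \<kappa> n = k}" for k
        using fin by (simp add: \<Delta>_def)
      show "summable (\<lambda>k. 3 * (2 ^ k / l k) + (l k * W (\<Delta> k) x) / 2)"
        using elim l_sum by (intro summable_add summable_mult summable_divide)
      have "\<forall>\<^sub>F k in sequentially. H k x < 1"
        using summable_LIMSEQ_zero[OF elim(1)] by (rule order_tendstoD) simp
      then show "\<forall>\<^sub>F k in sequentially. \<forall>m.
        \<bar>\<Sum>n | n \<in> \<sigma> ` {1..m} \<and> \<kappa> n = k. a n * q n x\<bar> \<le> 3 * (2 ^ k / l k) + (l k * W (\<Delta> k) x) / 2"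
      proof eventually_elim
        fix k assume small: "H k x < 1"
        have "\<bar>S B x\<bar> \<le> 3 * (2 ^ k / l k) + (l k * W (\<Delta> k) x) / 2" if B: "B \<in> C k" for B
        proof -
          \<comment> \<open>Enlarging \<open>B\<close> to the whole block makes the bound uniform in
            the position reached by the rearrangement.\<close>
          have "W B x \<le> W (\<Delta> k) x"
            unfolding W_def using B C_sub[of k] fin elim(3)
            by (intro sum_mono2) (auto simp: \<Delta>_def)
          then have W: "(l k)\<^sup>2 / 2 * W B x \<le> (l k)\<^sup>2 / 2 * W (\<Delta> k) x"
            by (intro mult_left_mono) auto
          have "s * S B x \<le> 3 * (2 ^ k / l k) + (l k * W (\<Delta> k) x) / 2" if s: "s = 1 \<or> s = -1" for s
          proof -
            have "Y k s B x \<le> Y k 1 B x + Y k (-1) B x"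
              using s by (auto simp: Y_def)
            also have "\<dots> \<le> (\<Sum>B\<in>C k. Y k 1 B x + Y k (-1) B x)"
              using B C_fin by (intro member_le_sum) (auto simp: Y_def)
            finally have "exp (- 3 * 2 ^ k) * Y k s B x \<le> H k x"
              unfolding H_def by (intro mult_left_mono) auto
            then have "exp (- 3 * 2 ^ k + (s * l k * S B x - (l k)\<^sup>2 / 2 * W B x)) < 1"
              using small by (simp only: Y_def exp_add)
            then have "- 3 * 2 ^ k + (s * l k * S B x - (l k)\<^sup>2 / 2 * W B x) < 0"
              by (metis exp_less_cancel_iff exp_zero)
            with W have "l k * (s * S B x) \<le> 3 * 2 ^ k + (l k)\<^sup>2 / 2 * W (\<Delta> k) x"
              by (simp add: mult_ac)
            also have "\<dots> = l k * (3 * (2 ^ k / l k) + (l k * W (\<Delta> k) x) / 2)"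
              using l_pos[of k] by (simp add: field_simps power2_eq_square)
            finally show ?thesis
              using l_pos[of k] by simp
          qed
          from this[of 1] this[of "-1"] show ?thesis by (simp add: abs_le_iff)
        qed
        then show "\<forall>m. \<bar>\<Sum>n | n \<in> \<sigma> ` {1..m} \<and> \<kappa> n = k. a n * q n x\<bar>
            \<le> 3 * (2 ^ k / l k) + (l k * W (\<Delta> k) x) / 2"
          by (auto simp: S_def C_def)
      qed
    qed
  qed
qed

end

text \<open>As the blocks do not overlap, a combination of block sums is one
  \<open>exp_process\<close> over their union, with coefficients constant on each block.
  Orthogonality bounds the integral of the proxy by 2.\<close>

lemma (in square_integrable_martingale_differences) self_normalized_system_blocks:
  assumes G: "\<And>n. 1 \<le> n \<Longrightarrow> finite (G n)" "\<And>n. 1 \<le> n \<Longrightarrow> G n \<subseteq> {1..}"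
    and disj: "disjoint_family_on G {1..}"
    and norm: "\<And>n. 1 \<le> n \<Longrightarrow> (\<integral>x. (\<Sum>j\<in>G n. d j x)\<^sup>2 \<partial>M) \<le> 1"
  shows "self_normalized_system M (\<lambda>n x. \<Sum>j\<in>G n. d j x) (\<lambda>n x. \<Sum>j\<in>G n. bracket j x)"
proof (intro self_normalized_system.intro prob_space_axioms self_normalized_system_axioms.intro)
  fix n :: nat assume n: "1 \<le> n"
  note Gn = G[OF n]
  show "integrable M (\<lambda>x. \<Sum>j\<in>G n. bracket j x)"
    using Gn integral_bracket(1) by (auto intro!: Bochner_Integration.integrable_sum)
  have "AE x in M. \<forall>j\<in>G n. 0 \<le> bracket j x"
  proof (rule AE_finite_allI[OF Gn(1)])
    fix j assume "j \<in> G n"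
    then have "1 \<le> j" using Gn by auto
    from square_le_bracket[OF this] show "AE x in M. 0 \<le> bracket j x"
      by eventually_elim (rule order_trans[OF zero_le_power2])
  qed
  then show "AE x in M. 0 \<le> (\<Sum>j\<in>G n. bracket j x)"
    by eventually_elim (auto intro: sum_nonneg)
  have "(\<integral>x. (\<Sum>j\<in>G n. bracket j x) \<partial>M) = 2 * (\<Sum>j\<in>G n. \<integral>x. (d j x)\<^sup>2 \<partial>M)"
    unfolding sum_distrib_left using Gn integral_bracket
    by (subst Bochner_Integration.integral_sum) (auto intro!: sum.cong)
  also have "\<dots> = 2 * (\<integral>x. (\<Sum>j\<in>G n. d j x)\<^sup>2 \<partial>M)"
    using integral_mult_sums[OF Gn Gn] by (simp add: power2_eq_square)
  finally show "(\<integral>x. (\<Sum>j\<in>G n. bracket j x) \<partial>M) \<le> 2"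
    using norm[OF n] by simp
next
  fix B :: "nat set" and b :: "nat \<Rightarrow> real"
  assume B: "finite B" "B \<subseteq> {1..}"
  \<comment> \<open>\<open>N j\<close> is the block containing \<open>j\<close>; it is evaluated
    only on the union \<open>D\<close>.\<close>
  define N where "N j = (THE n. 1 \<le> n \<and> j \<in> G n)" for j
  have N: "N j = n" if "1 \<le> n" "j \<in> G n" for j n
    unfolding N_def using that disj by (intro the_equality) (auto simp: disjoint_family_on_def)
  define D where "D = (\<Union>n\<in>B. G n)"
  have D: "finite D" "D \<subseteq> {1..}"
    using B G by (auto simp: D_def)
  have "exp_process (\<lambda>j. b (N j)) D
      = (\<lambda>x. exp (\<Sum>n\<in>B. b n * (\<Sum>j\<in>G n. d j x) - (b n)\<^sup>2 / 2 * (\<Sum>j\<in>G n. bracket j x)))"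
  proof
    fix x
    have "(\<Sum>j\<in>D. b (N j) * d j x - (b (N j))\<^sup>2 / 2 * bracket j x)
        = (\<Sum>n\<in>B. \<Sum>j\<in>G n. b (N j) * d j x - (b (N j))\<^sup>2 / 2 * bracket j x)"
      unfolding D_def using B G disj
      by (intro sum.UNION_disjoint) (auto simp: disjoint_family_on_def subset_eq)
    also have "\<dots> = (\<Sum>n\<in>B. \<Sum>j\<in>G n. b n * d j x - (b n)\<^sup>2 / 2 * bracket j x)"
      using B N by (intro sum.cong refl) auto
    finally show "exp_process (\<lambda>j. b (N j)) D x
        = exp (\<Sum>n\<in>B. b n * (\<Sum>j\<in>G n. d j x) - (b n)\<^sup>2 / 2 * (\<Sum>j\<in>G n. bracket j x))"
      by (simp add: exp_process_def sum_subtractf sum_distrib_left)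
  qed
  with integral_exp_process[OF D, of "\<lambda>j. b (N j)"]
  show "integrable M (\<lambda>x. exp (\<Sum>n\<in>B. b n * (\<Sum>j\<in>G n. d j x)
      - (b n)\<^sup>2 / 2 * (\<Sum>j\<in>G n. bracket j x)))"
    "(\<integral>x. exp (\<Sum>n\<in>B. b n * (\<Sum>j\<in>G n. d j x)
      - (b n)\<^sup>2 / 2 * (\<Sum>j\<in>G n. bracket j x)) \<partial>M) \<le> 2"
    by simp_all
qed

lemma (in martingale_differences) martingale_differences_scaled:
  "martingale_differences M F (\<lambda>j x. c j * d j x)"
proof (intro martingale_differences.intro prob_space_axioms martingale_differences_axioms.intro)
  fix n :: nat
  show "(\<lambda>x. c n * d n x) \<in> borel_measurable (F n)" if "1 \<le> n"
    using adapted[OF that] by simp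
  show "AE x in M. real_cond_exp M (F (n - 1)) (\<lambda>x. c n * d n x) x = 0" if n: "2 \<le> n"
  proof -
    interpret S: finite_measure_subalgebra M "F (n - 1)"
      by (rule finite_measure_subalgebra)
    have "1 \<le> n" using n by simp
    from S.real_cond_exp_cmult[OF integrable[OF this], of "c n"] cond_exp_zero[OF n]
    show ?thesis by eventually_elim simp
  qed
qed (use subalgebra subalgebra_mono integrable in auto)

section \<open>Filtrations of countable partitions\<close>

text \<open>Containing or missing a cell is inherited by complements and countable unions. Hence
  functions measurable over the generated algebra are constant on cells.\<close>

lemma sigma_sets_partition_atom:
  assumes "disjoint P" "P \<subseteq> Pow \<Omega>" "B \<in> sigma_sets \<Omega> P" "A \<in> P"
  shows "A \<subseteq> B \<or> A \<inter> B = {}"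
  using assms(3)
proof induction
  case (Basic B)
  then show ?case using assms by (auto simp: disjoint_def)
next
  case (Compl B)
  then show ?case using assms(2,4) by auto
next
  case (Union B)
  then show ?case by blast
qed simp

lemma borel_measurable_sigma_partition:
  fixes g :: "'a \<Rightarrow> real"
  assumes P: "countable P" "\<Union>P = \<Omega>"
    and const: "\<And>A. A \<in> P \<Longrightarrow> g constant_on A"
  shows "g \<in> borel_measurable (sigma \<Omega> P)"
proof (rule measurableI)
  have sub: "P \<subseteq> Pow \<Omega>" using P by auto
  fix S :: "real set"
  have "g -` S \<inter> space (sigma \<Omega> P) = \<Union>{A \<in> P. A \<subseteq> g -` S}"
  proof
    show "g -` S \<inter> space (sigma \<Omega> P) \<subseteq> \<Union>{A \<in> P. A \<subseteq> g -` S}"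
    proof
      fix x assume "x \<in> g -` S \<inter> space (sigma \<Omega> P)"
      then obtain A where "A \<in> P" "x \<in> A" "g x \<in> S"
        using P sub by (auto simp: space_measure_of)
      moreover from this have "A \<subseteq> g -` S"
        using const[of A] by (auto simp: constant_on_def)
      ultimately show "x \<in> \<Union>{A \<in> P. A \<subseteq> g -` S}" by blast
    qed
  qed (use P sub in \<open>auto simp: space_measure_of\<close>)
  also have "\<dots> \<in> sets (sigma \<Omega> P)"
    using P sub by (intro sets.countable_Union) (auto simp: sets_measure_of intro: countable_subset)
  finally show "g -` S \<inter> space (sigma \<Omega> P) \<in> sets (sigma \<Omega> P)" .
qed simp

text \<open>The conditional expectation is constant on a cell, and this constant times the measure
  of the cell is zero. So it vanishes there or the cell is null, and there are countably many
  cells.\<close>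

lemma (in finite_measure) real_cond_exp_partition_zero:
  assumes P: "countable P" "P \<subseteq> sets M" "disjoint P"
    and int: "integrable M h"
    and zero: "\<And>A. A \<in> P \<Longrightarrow> (\<integral>x\<in>A. h x \<partial>M) = 0"
    and cover: "\<Union>P = space M"
  shows "AE x in M. real_cond_exp M (sigma (space M) P) h x = 0"
proof -
  define F where "F = sigma (space M) P"
  have sub: "P \<subseteq> Pow (space M)"
    using P sets.space_closed by blast
  have sets_F: "sets F = sigma_sets (space M) P" and space_F: "space F = space M"
    using sub by (simp_all add: F_def sets_measure_of space_measure_of)
  interpret S: finite_measure_subalgebra M F
    by (intro finite_measure_subalgebra.intro finite_measure_axioms
        finite_measure_subalgebra_axioms.intro)
      (use sets.sigma_sets_subset[OF P(2)] in \<open>simp add: subalgebra_def sets_F space_F\<close>)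
  define e where "e = real_cond_exp M F h"
  have [measurable]: "e \<in> borel_measurable F"
    by (simp add: e_def)
  have "AE x in M. x \<in> A \<longrightarrow> e x = 0" if A: "A \<in> P" for A
  proof (cases "A = {}")
    case False
    then obtain a where a: "a \<in> A" by blast
    have AM: "A \<in> sets M" and AF: "A \<in> sets F"
      using A P by (auto simp: sets_F)
    \<comment> \<open>A level set of \<open>e\<close> that meets a cell contains it.\<close>
    have "{x \<in> space F. e x = e a} \<in> sets F" by measurable
    then have "A \<subseteq> {x \<in> space F. e x = e a}"
      using sigma_sets_partition_atom[OF P(3) sub _ A] a A sub
      unfolding sets_F space_F by blast
    then have "(\<integral>x\<in>A. e x \<partial>M) = (\<integral>x\<in>A. e a \<partial>M)"
      using AM by (intro set_lebesgue_integral_cong) auto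
    then have "e a * measure M A = 0"
      using S.real_cond_exp_intA[OF int AF] zero[OF A] AM
      by (auto simp: set_integral_const emeasure_eq_measure simp flip: e_def)
    then consider "e a = 0" | "measure M A = 0" by auto
    then show ?thesis
    proof cases
      case 1
      with \<open>A \<subseteq> _\<close> show ?thesis by (auto intro!: AE_I2)
    next
      case 2
      then have "A \<in> null_sets M"
        using AM by (simp add: null_sets_def emeasure_eq_measure)
      from AE_not_in[OF this] show ?thesis by eventually_elim simp
    qed
  qed simp
  then have "AE x in M. \<forall>A\<in>P. x \<in> A \<longrightarrow> e x = 0"
    by (intro AE_ball_countable[OF P(1), THEN iffD2] ballI)
  moreover have "AE x in M. x \<in> \<Union>P"
    unfolding cover by (rule AE_space)
  ultimately show ?thesis
    unfolding e_def F_def by eventually_elim blast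
qed

section \<open>Transfer to Lebesgue measure on the unit interval\<close>

lemma prob_space_unit_leb: "prob_space unit_leb"
  by (rule prob_spaceI) (simp add: emeasure_restrict_space)

lemma sets_unit_leb_iff: "A \<in> sets unit_leb \<longleftrightarrow> A \<in> sets lebesgue \<and> A \<subseteq> {0..<1}"
  by (auto simp: sets_restrict_space_iff)

lemma unit_partition_sets: "unit_partition P \<Longrightarrow> P \<subseteq> sets unit_leb"
  unfolding unit_partition_def by (metis Union_upper sets_unit_leb_iff subset_iff)

text \<open>Nothing is known about \<open>\<A> 0\<close>, so \<open>max 1 n\<close> makes level 0 a
  copy of level 1. Vanishing cell integrals become vanishing conditional expectations by
  \<open>real_cond_exp_partition_zero\<close>.\<close>

lemma martingale_differences_unit_leb:
  assumes filt: "filtration \<A>" and md: "martingale_difference_wrt \<A> f"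
  shows "martingale_differences unit_leb (\<lambda>n. sigma {0..<1} (\<A> (max 1 n))) f"
proof -
  interpret prob_space unit_leb by (rule prob_space_unit_leb)
  define F where "F n = sigma {0..<1} (\<A> (max 1 n))" for n :: nat
  have part: "unit_partition (\<A> n)" if "1 \<le> n" for n
    using filt that by (auto simp: filtration_def)
  have sub: "\<A> (max 1 n) \<subseteq> Pow {0..<1}" for n :: nat
    using part[of "max 1 n"] by (auto simp: unit_partition_def)
  have sets_F: "sets (F n) = sigma_sets {0..<1} (\<A> (max 1 n))" for n
    using sub by (simp add: F_def sets_measure_of)
  have space_F: "space (F n) = {0..<1}" for n
    using sub by (simp add: F_def space_measure_of)
  \<comment> \<open>Each cell is a countable union of its children, so the generators of one level
    are measurable at the next.\<close>
  have "sets (F n) \<subseteq> sets (F (Suc n))" for n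
  proof (cases "n = 0")
    case False
    have "\<A> n \<subseteq> sets (F (Suc n))"
    proof
      fix A assume "A \<in> \<A> n"
      then obtain \<C> where \<C>: "\<C> \<subseteq> \<A> (n + 1)" "A = \<Union>\<C>"
        using filt False unfolding filtration_def
        by (metis One_nat_def Suc_leI bot_nat_0.not_eq_extremum)
      then have "countable \<C>"
        using part[of "n + 1"] by (auto simp: unit_partition_def intro: countable_subset)
      moreover have "\<C> \<subseteq> sets (F (Suc n))"
        using \<C> by (auto simp: sets_F)
      ultimately show "A \<in> sets (F (Suc n))"
        unfolding \<C>(2) by (rule sets.countable_Union)
    qed
    then show ?thesis
      using False sets.sigma_sets_subset[of "\<A> n" "F (Suc n)"] by (simp add: sets_F[of n] space_F max_def)
  qed (simp add: F_def)
  then have F_mono: "sets (F m) \<subseteq> sets (F n)" if "m \<le> n" for m n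
    using that by (rule lift_Suc_mono_le)
  show ?thesis
    unfolding F_def[symmetric]
  proof (intro martingale_differences.intro prob_space_axioms martingale_differences_axioms.intro)
    fix n :: nat
    have "sigma_sets (space unit_leb) (\<A> (max 1 n)) \<subseteq> sets unit_leb"
      by (intro sets.sigma_sets_subset unit_partition_sets part) simp
    then show "subalgebra unit_leb (F n)"
      by (simp add: subalgebra_def sets_F space_F)
    show "subalgebra (F n) (F m)" if "m \<le> n" for m
      using F_mono[OF that] by (simp add: subalgebra_def space_F)
    show "f n \<in> borel_measurable (F n)" if "1 \<le> n"
      unfolding F_def using that md part[of n]
      by (intro borel_measurable_sigma_partition)
        (auto simp: martingale_difference_wrt_def unit_partition_def max_def)
    show int: "integrable unit_leb (f n)" if "1 \<le> n"
      using that md by (auto simp: martingale_difference_wrt_def)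
    show "AE x in unit_leb. real_cond_exp unit_leb (F (n - 1)) (f n) x = 0" if n: "2 \<le> n"
    proof -
      have P: "unit_partition (\<A> (n - 1))"
        using part n by simp
      have "(\<integral>x\<in>A. f n x \<partial>unit_leb) = 0" if A: "A \<in> \<A> (n - 1)" for A
      proof -
        have "A \<subseteq> {0..<1}" using A P by (auto simp: unit_partition_def)
        then have "(\<integral>x\<in>A. f n x \<partial>unit_leb) = (LINT x:A|lebesgue. f n x)"
          unfolding set_lebesgue_integral_def
          by (subst integral_restrict_space) (auto intro!: Bochner_Integration.integral_cong simp: indicator_def)
        then show ?thesis
          using A n md by (auto simp: martingale_difference_wrt_def)
      qed
      then have "AE x in unit_leb. real_cond_exp unit_leb (sigma (space unit_leb) (\<A> (n - 1))) (f n) x = 0"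
        using P unit_partition_sets[OF P] int n
        by (intro real_cond_exp_partition_zero) (auto simp: unit_partition_def)
      moreover have "max 1 (n - 1) = n - 1"
        using n by simp
      ultimately show ?thesis by (simp add: F_def)
    qed
  qed
qed

theorem corollary1p3:
  fixes f p :: "nat \<Rightarrow> real \<Rightarrow> real"
    and G :: "nat \<Rightarrow> nat set"
    and c \<omega> :: "nat \<Rightarrow> real"
  assumes "martingale_difference f"
    and "\<And>n. n \<ge> 1 \<Longrightarrow> finite (G n) \<and> G n \<subseteq> {1..}"
    and "disjoint_family_on G {1..}"
    and "\<And>n x. n \<ge> 1 \<Longrightarrow> x \<in> {0..<1} \<Longrightarrow> p n x = (\<Sum>j\<in>G n. c j * f j x)"
    and "\<And>n. n \<ge> 1 \<Longrightarrow> L2_normalized (p n)"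
    and "\<And>n. n \<ge> 1 \<Longrightarrow> 0 < \<omega> n"
    and "increases_to_infinity \<omega>"
    and "mono_on {2..} (\<lambda>n. \<omega> n / log 2 (real n))"
    and "summable (\<lambda>k. 1 / (real (Suc k) * \<omega> (Suc k)))"
  shows "UC_multiplier \<omega> p"
proof -
  obtain \<A> where \<A>: "filtration \<A>" "martingale_difference_wrt \<A> f"
    using assms(1) by (auto simp: martingale_difference_def)
  define F where "F n = sigma {0..<1} (\<A> (max 1 n))" for n :: nat
  interpret f: martingale_differences unit_leb F f
    unfolding F_def by (rule martingale_differences_unit_leb[OF \<A>])
  define U where "U = (\<Union>n\<in>{1..}. G n)"
  \<comment> \<open>Differences outside all spectra need not be square integrable and are switched off.\<close>
  define d where "d j x = (if j \<in> U then c j else 0) * f j x" for j x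
  have p_eq: "p n x = (\<Sum>j\<in>G n. d j x)" if "1 \<le> n" "x \<in> {0..<1}" for n x
    using assms(4)[OF that] that(1) by (auto simp: d_def U_def intro!: sum.cong)
  have p_int: "(\<integral>x. p m x * p n x \<partial>unit_leb) = (\<integral>x. (\<Sum>j\<in>G m. d j x) * (\<Sum>j\<in>G n. d j x) \<partial>unit_leb)"
    if "1 \<le> m" "1 \<le> n" for m n
    using p_eq that by (intro Bochner_Integration.integral_cong) auto
  interpret d: square_integrable_martingale_differences unit_leb F d
  proof (intro square_integrable_martingale_differences.intro
      square_integrable_martingale_differences_axioms.intro)
    show "martingale_differences unit_leb F d"
      unfolding d_def by (rule f.martingale_differences_scaled)
    fix j :: nat assume "1 \<le> j"
    show "integrable unit_leb (\<lambda>x. (d j x)\<^sup>2)"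
    proof (cases "j \<in> U")
      case True
      \<comment> \<open>The square integrability of \<open>c j * f j\<close> comes from the
        normalized polynomial in which it occurs.\<close>
      then obtain n where n: "1 \<le> n" "j \<in> G n" by (auto simp: U_def)
      have "integrable unit_leb (\<lambda>x. (p n x)\<^sup>2)"
        using assms(5)[OF n(1)] by (simp add: L2_normalized_def in_L2_def)
      then have "integrable unit_leb (\<lambda>x. (\<Sum>j\<in>G n. c j * f j x)\<^sup>2)"
        by (rule Bochner_Integration.integrable_cong[THEN iffD1, rotated 2])
          (use assms(4) n in auto)
      then have "integrable unit_leb (\<lambda>x. (c j * f j x)\<^sup>2)"
        using assms(2)[OF n(1)] n by (intro f.square_integrable_term[of "G n" j c]) auto
      then show ?thesis using True by (simp add: d_def)
    qed (simp add: d_def)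
  qed
  have norm: "(\<integral>x. (\<Sum>j\<in>G n. d j x)\<^sup>2 \<partial>unit_leb) = 1" if "1 \<le> n" for n
    using assms(5)[OF that] p_int[OF that that] by (simp add: L2_normalized_def power2_eq_square)
  have ortho: "(\<integral>x. p m x * p n x \<partial>unit_leb) = 0" if "1 \<le> m" "1 \<le> n" "m \<noteq> n" for m n
  proof -
    have "G m \<inter> G n = {}"
      using assms(3) that by (auto simp: disjoint_family_on_def)
    then show ?thesis
      using p_int[OF that(1,2)] d.integral_mult_sums[of "G m" "G n"]
        assms(2)[OF that(1)] assms(2)[OF that(2)] by simp
  qed
  interpret q: self_normalized_system unit_leb "\<lambda>n x. \<Sum>j\<in>G n. d j x" "\<lambda>n x. \<Sum>j\<in>G n. d.bracket j x"
    by (rule d.self_normalized_system_blocks) (use assms(2,3) norm in auto)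
  have mono: "mono_on {1..} \<omega>"
    using assms(7) by (simp add: increases_to_infinity_def)
  \<comment> \<open>This is the integer part of the iterated binary logarithm. Since
    \<open>floor_log 0 = 0\<close>, block 0 consists of the indices 1, 2, 3.\<close>
  define \<kappa> where "\<kappa> n = floor_log (floor_log n)" for n
  \<comment> \<open>Block 0 contains the index 1, which lies below \<open>2 ^ 2 ^ 0 = 2\<close>, so
    its lower bound has to be \<open>\<omega> 1\<close>.\<close>
  define l where "l k = (if k = 0 then \<omega> 1 else \<omega> (2 ^ 2 ^ k))" for k :: nat
  have \<kappa>: "n < 4 ^ 2 ^ \<kappa> n" for n
  proof -
    have "n < 2 ^ Suc (floor_log n)"
      using floor_log_exp2_gt[of n] by simp
    also have "\<dots> \<le> 2 ^ (2 * 2 ^ \<kappa> n)"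
      using floor_log_exp2_gt[of "floor_log n"] by (intro power_increasing) (auto simp: \<kappa>_def)
    finally show ?thesis by (simp add: power_mult)
  qed
  have l_pos: "0 < l k" for k
    using assms(6) by (simp add: l_def)
  have l_le: "l (\<kappa> n) \<le> \<omega> n" if n: "1 \<le> n" for n
  proof (cases "\<kappa> n = 0")
    case True
    then show ?thesis using mono_onD[OF mono, of 1 n] n by (simp add: l_def)
  next
    case False
    then have "0 < floor_log n"
      by (auto simp: \<kappa>_def intro!: gr0I)
    then have "2 ^ \<kappa> n \<le> floor_log n"
      unfolding \<kappa>_def by (rule floor_log_exp2_le)
    then have "(2 :: nat) ^ 2 ^ \<kappa> n \<le> 2 ^ floor_log n"
      by (intro power_increasing) auto
    also have "\<dots> \<le> n"
      using n by (intro floor_log_exp2_le) simp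
    finally show ?thesis
      using False mono_onD[OF mono, of "2 ^ 2 ^ \<kappa> n" n] n by (simp add: l_def)
  qed
  \<comment> \<open>The exceptional value at \<open>k = 0\<close> does not affect
    summability.\<close>
  have "\<forall>\<^sub>F k in sequentially. 2 ^ k / l k = 2 ^ k / \<omega> (2 ^ 2 ^ k)"
    using eventually_gt_at_top[of 0] by eventually_elim (simp add: l_def)
  then have l_sum: "summable (\<lambda>k. 2 ^ k / l k)"
    by (rule summable_cong[THEN iffD2]) (use summable_double_condensation[of \<omega>] assms(6,9) mono in auto)
  have "unconditionally_convergent_ae (\<lambda>n x. a n * p n x)"
    if a: "summable (\<lambda>k. (a (Suc k))\<^sup>2 * \<omega> (Suc k))" for a
    unfolding unconditionally_convergent_ae_def
  proof (intro allI impI)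
    fix \<sigma> :: "nat \<Rightarrow> nat" assume \<sigma>: "bij_betw \<sigma> {1..} {1..}"
    have \<sigma>_ge: "1 \<le> \<sigma> (Suc k)" for k
      using bij_betw_apply[OF \<sigma>, of "Suc k"] by simp
    have "AE x in unit_leb. summable (\<lambda>k. a (\<sigma> (Suc k)) * (\<Sum>j\<in>G (\<sigma> (Suc k)). d j x))"
      by (rule q.rearrangement_converges_AE[OF \<sigma> _ l_pos _ l_sum a]) (use \<kappa> l_le in auto)
    moreover have "AE x in unit_leb. x \<in> {0..<1}"
      using AE_space[of unit_leb] by simp
    ultimately show "AE x in unit_leb. summable (\<lambda>k. a (\<sigma> (Suc k)) * p (\<sigma> (Suc k)) x)"
      by eventually_elim (simp add: p_eq[OF \<sigma>_ge])
  qed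
  then show ?thesis
    using assms(5-7) ortho by (simp add: UC_multiplier_def orthonormal_system_def)
qed

end
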